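(* Let $X$ be an Archimedean pervasive pre-Riesz space, with Dedekind completion $X^\delta$ and embedding $i\colon X\to X^\delta$. Let $I\subseteq X$ be a directed ideal and $\hat{I}$ the smallest extension ideal of $I$ in $X^\delta$. Then $(\hat{I},i|_{I})$ is the Dedekind completion of $I$, and $I$ is pervasive.
   Context: All ordered vector spaces are real vector spaces with a partial order given by a cone $X_+$ ($x\le y$ iff $y-x\in X_+$); linear subspaces carry the induced order. $X$ is Archimedean if $nx\le y$ for all $n\in\mathbb{N}$ implies $x\le 0$. A linear subspace $D$ is directed if any two elements of $D$ have an upper bound in $D$. A linear subspace $D$ of an ordered vector space $Z$ is order dense in $Z$ if for every $z\in Z$ one has $z=\inf\{d\in D: z\le d\}$ (infimum in $Z$). A linear map $i$ is bipositive if $i(x)\ge 0\iff x\ge 0$. An ordered vector space $X$ is pre-Riesz if there are a vector lattice $Y$ and a bipositive linear map $i\colon X\to Y$ with $i(X)$ order dense in $Y$; then $(Y,i)$ is called a vector lattice cover of $X$. A pre-Riesz space $X$ is pervasive if for a vector lattice cover $(Y,i)$ (equivalently, for every vector lattice cover) and every $y\in Y_+$, $y\ne 0$, there is $x\in X$ with $0<i(x)\le y$. The Dedekind completion of an Archimedean directed ordered vector space $X$ is the (unique up to isomorphism) vector lattice cover $(X^\delta,i)$ of $X$ with $X^\delta$ Dedekind complete (every non-empty subset bounded above has a supremum). For $M\subseteq X$ let $M^u$ be the set of upper bounds of $M$ in $X$. A set $M\subseteq X$ is solid if $x\in X$, $y\in M$ and $\{x,-x\}^u\supseteq\{y,-y\}^u$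 imply $x\in M$. An ideal is a solid linear subspace (in a vector lattice this is the usual notion). An ideal $J$ of $X^\delta$ is an extension ideal of an ideal $I$ of $X$ if $I=\{x\in X: i(x)\in J\}$. If $I$ has an extension ideal (every directed ideal does), then $\hat I$, the intersection of all its extension ideals, is the smallest extension ideal of $I$. *)

theory Defs
  imports Complex_Main "HOL-Library.Lub_Glb"
begin

text \<open>
  An ordered vector space is rendered as a linear subspace \<open>X\<close> of a type of class
  \<open>ordered_real_vector\<close>, with the induced order. Any ordered vector space is covered, by taking
  \<open>X = UNIV\<close>; using carriers lets a subspace of \<open>X\<close> be treated as an ordered vector space
  in its own right. Upper bounds, suprema and infima are therefore relative to the carrier:
  \<open>isUb\<close>, \<open>isLub\<close> and \<open>isGlb\<close> take it as their first argument.
\<close>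

definition linear_on :: "'a::real_vector set \<Rightarrow> ('a \<Rightarrow> 'b::real_vector) \<Rightarrow> bool" where
  "linear_on X i \<longleftrightarrow>
     (\<forall>x\<in>X. \<forall>y\<in>X. i (x + y) = i x + i y) \<and> (\<forall>c. \<forall>x\<in>X. i (c *\<^sub>R x) = c *\<^sub>R i x)"

definition archimedean_on :: "'a::ordered_real_vector set \<Rightarrow> bool" where
  "archimedean_on X \<longleftrightarrow> (\<forall>x\<in>X. \<forall>y\<in>X. (\<forall>n::nat. real n *\<^sub>R x \<le> y) \<longrightarrow> x \<le> 0)"

definition directed :: "'a::ordered_real_vector set \<Rightarrow> bool" where
  "directed D \<longleftrightarrow> (\<forall>x\<in>D. \<forall>y\<in>D. \<exists>z\<in>D. x \<le> z \<and> y \<le> z)"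

definition order_dense_in :: "'a::ordered_real_vector set \<Rightarrow> 'a set \<Rightarrow> bool" where
  "order_dense_in Z D \<longleftrightarrow> subspace D \<and> D \<subseteq> Z \<and> (\<forall>z\<in>Z. isGlb Z {d \<in> D. z \<le> d} z)"

definition bipositive_on ::
    "'a::ordered_real_vector set \<Rightarrow> ('a \<Rightarrow> 'b::ordered_real_vector) \<Rightarrow> bool" where
  "bipositive_on X i \<longleftrightarrow> (\<forall>x\<in>X. 0 \<le> i x \<longleftrightarrow> 0 \<le> x)"

text \<open>Binary infima need not be required: they are \<open>- sup {- x, - y}\<close>.\<close>

definition vector_lattice_on :: "'a::ordered_real_vector set \<Rightarrow> bool" where
  "vector_lattice_on Y \<longleftrightarrow> subspace Y \<and> (\<forall>x\<in>Y. \<forall>y\<in>Y. \<exists>s. isLub Y {x, y} s)"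

definition dedekind_complete_on :: "'a::ordered_real_vector set \<Rightarrow> bool" where
  "dedekind_complete_on Y \<longleftrightarrow>
     (\<forall>M. M \<subseteq> Y \<longrightarrow> M \<noteq> {} \<longrightarrow> (\<exists>u. isUb Y M u) \<longrightarrow> (\<exists>s. isLub Y M s))"

text \<open>
  The next three predicates depend only on the values of \<open>i\<close> on \<open>X\<close>, so that applying them to
  \<open>i\<close> and a subspace of \<open>X\<close> speaks about the restriction of \<open>i\<close> to that subspace.
  \<open>X\<close> is a pre-Riesz space precisely if it has a vector lattice cover \<open>(Y, i)\<close>.
\<close>

definition vector_lattice_cover ::
    "'a::ordered_real_vector set \<Rightarrow> 'b::ordered_real_vector set \<Rightarrow> ('a \<Rightarrow> 'b) \<Rightarrow> bool" where
  "vector_lattice_cover X Y i \<longleftrightarrow>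
     subspace X \<and> vector_lattice_on Y \<and> linear_on X i \<and> i ` X \<subseteq> Y \<and>
     bipositive_on X i \<and> order_dense_in Y (i ` X)"

definition pervasive_via ::
    "'a::ordered_real_vector set \<Rightarrow> 'b::ordered_real_vector set \<Rightarrow> ('a \<Rightarrow> 'b) \<Rightarrow> bool" where
  "pervasive_via X Y i \<longleftrightarrow>
     vector_lattice_cover X Y i \<and> (\<forall>y\<in>Y. 0 < y \<longrightarrow> (\<exists>x\<in>X. 0 < i x \<and> i x \<le> y))"

definition dedekind_completion ::
    "'a::ordered_real_vector set \<Rightarrow> 'b::ordered_real_vector set \<Rightarrow> ('a \<Rightarrow> 'b) \<Rightarrow> bool" where
  "dedekind_completion X Y i \<longleftrightarrow>
     archimedean_on X \<and> directed X \<and> vector_lattice_cover X Y i \<and> dedekind_complete_on Y"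

definition solid_in :: "'a::ordered_real_vector set \<Rightarrow> 'a set \<Rightarrow> bool" where
  "solid_in X M \<longleftrightarrow> M \<subseteq> X \<and>
     (\<forall>x\<in>X. \<forall>y\<in>M. {u. isUb X {y, - y} u} \<subseteq> {u. isUb X {x, - x} u} \<longrightarrow> x \<in> M)"

definition ideal_in :: "'a::ordered_real_vector set \<Rightarrow> 'a set \<Rightarrow> bool" where
  "ideal_in X I \<longleftrightarrow> subspace I \<and> solid_in X I"

definition extension_ideal ::
    "'a::ordered_real_vector set \<Rightarrow> 'b::ordered_real_vector set \<Rightarrow> ('a \<Rightarrow> 'b) \<Rightarrow>
     'a set \<Rightarrow> 'b set \<Rightarrow> bool" where
  "extension_ideal X Y i I J \<longleftrightarrow> ideal_in Y J \<and> I = {x \<in> X. i x \<in> J}"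

text \<open>Meaningful only if an extension ideal exists (otherwise the intersection is \<open>UNIV\<close>).\<close>

definition smallest_extension_ideal ::
    "'a::ordered_real_vector set \<Rightarrow> 'b::ordered_real_vector set \<Rightarrow> ('a \<Rightarrow> 'b) \<Rightarrow>
     'a set \<Rightarrow> 'b set" where
  "smallest_extension_ideal X Y i I = \<Inter>{J. extension_ideal X Y i I J}"

end

theory Submission
  imports Defs
begin

text \<open>
  Pervasiveness has a description inside \<open>X\<close> (\<open>pervasive_via_iff\<close>), so it does not depend on the
  cover. The smallest extension ideal \<open>J\<close> consists of the elements of \<open>X\<^sup>\<delta>\<close> lying in some \<open>[- i a, i a]\<close> with
  \<open>a \<in> I\<close>. The only real point is that \<open>i(I)\<close> is order dense in \<open>J\<close>. If \<open>w\<close> is a lower bound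
  of \<open>{i d | d \<in> I, z \<le> i d}\<close> and \<open>w \<le> z\<close> fails, replace \<open>w\<close> by \<open>w \<squnion> z\<close> and use pervasiveness
  to get \<open>0 < i x \<le> w - z\<close>; then \<open>x \<in> I\<close>, the set is stable under \<open>d \<mapsto> d - x\<close>, and so all
  multiples of \<open>x\<close> stay below a fixed element, against the Archimedean property.
\<close>

section \<open>Suprema, infima and differences relative to a carrier\<close>

lemma isLub_iff:
  "isLub Y M s \<longleftrightarrow> s \<in> Y \<and> (\<forall>m\<in>M. m \<le> s) \<and> (\<forall>u\<in>Y. (\<forall>m\<in>M. m \<le> u) \<longrightarrow> s \<le> u)"
  by (auto simp: isLub_def leastP_def isUb_def setle_def setge_def)

lemma isGlb_iff:
  "isGlb Y M s \<longleftrightarrow> s \<in> Y \<and> (\<forall>m\<in>M. s \<le> m) \<and> (\<forall>u\<in>Y. (\<forall>m\<in>M. u \<le> m) \<longrightarrow> u \<le> s)"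
  by (auto simp: isGlb_def greatestP_def isLb_def setle_def setge_def)

lemma linear_on_diff:
  assumes "linear_on X i" "subspace X" "x \<in> X" "y \<in> X"
  shows "i (x - y) = i x - i y"
proof -
  have "- y \<in> X" "i (- y) = - i y"
    using assms subspace_neg[of X y] by (auto simp: linear_on_def dest!: spec[of _ "-1"] bspec[of X _ y])
  then show ?thesis
    using assms unfolding linear_on_def by (metis add_uminus_conv_diff)
qed

section \<open>Vector lattice covers and an intrinsic form of pervasiveness\<close>

context
  fixes X :: "'a::ordered_real_vector set" and Y :: "'b::ordered_real_vector set" and i
  assumes cover: "vector_lattice_cover X Y i"
begin

lemma cover_subspaces: "subspace X" "subspace Y"
  using cover by (auto simp: vector_lattice_cover_def vector_lattice_on_def)

lemma cover_in: "x \<in> X \<Longrightarrow> i x \<in> Y"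
  using cover by (auto simp: vector_lattice_cover_def)

lemma cover_linear: "linear_on X i"
  using cover by (simp add: vector_lattice_cover_def)

lemma cover_add: "x \<in> X \<Longrightarrow> y \<in> X \<Longrightarrow> i (x + y) = i x + i y"
  using cover_linear by (simp add: linear_on_def)

lemma cover_scale: "x \<in> X \<Longrightarrow> i (c *\<^sub>R x) = c *\<^sub>R i x"
  using cover_linear by (simp add: linear_on_def)

lemma cover_diff: "x \<in> X \<Longrightarrow> y \<in> X \<Longrightarrow> i (x - y) = i x - i y"
  by (rule linear_on_diff[OF cover_linear cover_subspaces(1)])

lemma cover_zero: "i 0 = 0"
  using cover_diff[of 0 0] subspace_0[OF cover_subspaces(1)] by simp

lemma cover_neg: "x \<in> X \<Longrightarrow> i (- x) = - i x"
  using cover_diff[of 0 x] subspace_0[OF cover_subspaces(1)] by (simp add: cover_zero)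

lemma cover_le: "x \<in> X \<Longrightarrow> y \<in> X \<Longrightarrow> i x \<le> i y \<longleftrightarrow> x \<le> y"
  using cover cover_diff[of y x] subspace_diff[OF cover_subspaces(1), of y x]
  by (metis bipositive_on_def diff_ge_0_iff_ge vector_lattice_cover_def)

lemma cover_less: "x \<in> X \<Longrightarrow> y \<in> X \<Longrightarrow> i x < i y \<longleftrightarrow> x < y"
  by (simp add: less_le_not_le cover_le)

lemma cover_pos: "x \<in> X \<Longrightarrow> 0 < i x \<longleftrightarrow> 0 < x"
  using cover_less[of 0 x] subspace_0[OF cover_subspaces(1)] by (simp add: cover_zero)

lemma cover_sup:
  assumes "x \<in> Y" "y \<in> Y"
  obtains s where "s \<in> Y" "x \<le> s" "y \<le> s" "\<And>u. u \<in> Y \<Longrightarrow> x \<le> u \<Longrightarrow> y \<le> u \<Longrightarrow> s \<le> u"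
proof -
  have "\<exists>s. isLub Y {x, y} s"
    using cover assms unfolding vector_lattice_cover_def vector_lattice_on_def by blast
  then show thesis
    using that unfolding isLub_iff by blast
qed

lemma cover_dense_above:
  assumes "z \<in> Y" "w \<in> Y" "\<And>x. x \<in> X \<Longrightarrow> z \<le> i x \<Longrightarrow> w \<le> i x"
  shows "w \<le> z"
proof -
  have "isGlb Y {d \<in> i ` X. z \<le> d} z"
    using cover assms(1) unfolding vector_lattice_cover_def order_dense_in_def by blast
  then show ?thesis
    using assms(2,3) unfolding isGlb_iff by blast
qed

text \<open>Negation maps \<open>X\<close> onto itself and reverses the order, so order density from
  above turns into order density from below.\<close>

lemma cover_dense_below:
  assumes "z \<in> Y" "w \<in> Y" "\<And>x. x \<in> X \<Longrightarrow> i x \<le> z \<Longrightarrow> i x \<le> w"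
  shows "z \<le> w"
proof -
  have "- w \<le> - z"
  proof (rule cover_dense_above)
    fix x assume x: "x \<in> X" "- z \<le> i x"
    then have "i (- x) \<le> w"
      using assms(3)[of "- x"] subspace_neg[OF cover_subspaces(1)]
      by (simp add: cover_neg minus_le_iff)
    then show "- w \<le> i x"
      using x by (simp add: cover_neg minus_le_iff)
  qed (use assms(1,2) subspace_neg[OF cover_subspaces(2)] in simp_all)
  then show ?thesis by simp
qed

text \<open>By order density, \<open>x\<close> lies below every upper bound in \<open>X\<close> of 0
  and \<open>d\<close> exactly if \<open>i x\<close> is at most the positive part of
  \<open>i d\<close>. So the condition asks for pervasiveness only below these positive parts, yet
  names nothing outside \<open>X\<close>.\<close>

lemma pervasive_via_iff:
  "pervasive_via X Y i \<longleftrightarrow>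
     (\<forall>d\<in>X. \<not> d \<le> 0 \<longrightarrow> (\<exists>x\<in>X. 0 < x \<and> (\<forall>u\<in>X. 0 \<le> u \<longrightarrow> d \<le> u \<longrightarrow> x \<le> u)))"
  (is "_ \<longleftrightarrow> ?intrinsic")
proof
  have X0: "0 \<in> X" and Y0: "0 \<in> Y"
    using cover_subspaces by (auto simp: subspace_0)
  show ?intrinsic if p: "pervasive_via X Y i"
  proof (intro ballI impI)
    fix d assume d: "d \<in> X" "\<not> d \<le> 0"
    \<comment> \<open>\<open>s\<close> is the positive part of \<open>i d\<close> in
      \<open>Y\<close>; it is nonzero because \<open>d\<close> is not below 0.\<close>
    obtain s where s: "s \<in> Y" "i d \<le> s" "0 \<le> s"
      "\<And>u. u \<in> Y \<Longrightarrow> i d \<le> u \<Longrightarrow> 0 \<le> u \<Longrightarrow> s \<le> u"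
      using cover_sup[OF cover_in[OF d(1)] Y0] by blast
    have "s \<noteq> 0"
      using s(2) d cover_le[OF d(1) X0] by (auto simp: cover_zero)
    then have "0 < s" using s by simp
    then obtain x where x: "x \<in> X" "0 < i x" "i x \<le> s"
      using p s(1) unfolding pervasive_via_def by blast
    have "x \<le> u" if u: "u \<in> X" "0 \<le> u" "d \<le> u" for u
    proof -
      have "s \<le> i u"
        using u d s(4)[of "i u"] cover_in cover_le X0 cover_zero by metis
      then show ?thesis
        using x u cover_le order_trans by metis
    qed
    then show "\<exists>x\<in>X. 0 < x \<and> (\<forall>u\<in>X. 0 \<le> u \<longrightarrow> d \<le> u \<longrightarrow> x \<le> u)"
      using x cover_pos by blast
  qed
  show "pervasive_via X Y i" if p: ?intrinsic
    unfolding pervasive_via_def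
  proof (intro conjI ballI impI cover)
    fix y assume y: "y \<in> Y" "0 < y"
    \<comment> \<open>If every image below \<open>y\<close> were at most 0, order density from below
      would give \<open>y \<le> 0\<close>.\<close>
    then obtain d where d: "d \<in> X" "i d \<le> y" "\<not> i d \<le> 0"
      using cover_dense_below[OF y(1) Y0] by (meson less_le_not_le)
    then have "\<not> d \<le> 0"
      using cover_le[OF d(1) X0] by (simp add: cover_zero)
    then have "\<exists>x\<in>X. 0 < x \<and> (\<forall>u\<in>X. 0 \<le> u \<longrightarrow> d \<le> u \<longrightarrow> x \<le> u)"
      using p d(1) by simp
    then obtain x where
      x: "x \<in> X" "0 < x" "\<And>u. u \<in> X \<Longrightarrow> 0 \<le> u \<Longrightarrow> d \<le> u \<Longrightarrow> x \<le> u"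
      by auto
    \<comment> \<open>It suffices to compare \<open>i x\<close> with the images \<open>i u\<close>
      above \<open>y\<close>; each such \<open>u\<close> is above both 0 and
      \<open>d\<close>.\<close>
    have "i x \<le> y"
    proof (rule cover_dense_above)
      fix u assume u: "u \<in> X" "y \<le> i u"
      then have "i 0 \<le> i u" "i d \<le> i u"
        using y d by (auto simp: cover_zero intro: order_trans less_imp_le)
      then show "i x \<le> i u"
        using x u d X0 by (simp add: cover_le)
    qed (use x y cover_in in auto)
    then show "\<exists>x\<in>X. 0 < i x \<and> i x \<le> y"
      using x cover_pos by blast
  qed
qed

end

text \<open>Both covers satisfy the same condition on \<open>X\<close>, in which neither
  \<open>Y\<close> nor \<open>Z\<close> occurs.\<close>

lemma pervasive_via_transfer:
  assumes "pervasive_via X Y i" "vector_lattice_cover X Z k"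
  shows "pervasive_via X Z k"
  using assms pervasive_via_iff[of X Y i] pervasive_via_iff[of X Z k]
  by (simp add: pervasive_via_def)

section \<open>Ideals and the smallest extension ideal\<close>

lemma solid_inD:
  assumes "solid_in X M" "y \<in> M" "x \<in> X" "x \<le> y" "- y \<le> x"
  shows "x \<in> M"
proof -
  \<comment> \<open>The two inequalities say that \<open>y\<close> is above \<open>x\<close> and
    above \<open>- x\<close>, hence so is every upper bound of \<open>y\<close>.\<close>
  have "{u. isUb X {y, - y} u} \<subseteq> {u. isUb X {x, - x} u}"
    using assms(4,5) minus_le_iff[of y x]
    by (auto simp: isUb_def setle_def intro: order_trans)
  then show ?thesis
    using assms(1-3) unfolding solid_in_def by blast
qed

context
  fixes X :: "'a::ordered_real_vector set" and Y :: "'b::ordered_real_vector set" and i I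
  assumes cover: "vector_lattice_cover X Y i"
    and ideal: "ideal_in X I" and directed: "directed I"
begin

lemma ideal_simps: "subspace I" "solid_in X I" "I \<subseteq> X"
  using ideal by (auto simp: ideal_in_def solid_in_def)

lemma directed_abs_bound:
  assumes "a \<in> I"
  obtains c where "c \<in> I" "a \<le> c" "- a \<le> c"
  using assms directed subspace_neg[OF ideal_simps(1) assms] unfolding directed_def by blast

text \<open>The union of the intervals between \<open>- i a\<close> and \<open>i a\<close> is an
  extension ideal. Any other one contains each \<open>i a\<close> with \<open>a\<close> in
  \<open>I\<close> and therefore, by solidity, the whole interval.\<close>

lemma smallest_extension_ideal_eq:
  "smallest_extension_ideal X Y i I = {z \<in> Y. \<exists>a\<in>I. z \<le> i a \<and> - i a \<le> z}" (is "_ = ?J")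
  and extension_ideal_smallest: "extension_ideal X Y i I (smallest_extension_ideal X Y i I)"
proof -
  note [simp] = cover_add[OF cover] cover_scale[OF cover] cover_neg[OF cover]
  have IX: "x \<in> X" if "x \<in> I" for x using that ideal_simps by auto
  have I_in_J: "i x \<in> ?J" if x: "x \<in> I" for x
  proof -
    obtain c where "c \<in> I" "x \<le> c" "- x \<le> c"
      using directed_abs_bound[OF x] .
    moreover from this have "- c \<le> x" by (simp add: minus_le_iff)
    moreover have "- c \<in> X" using \<open>c \<in> I\<close> by (simp add: IX ideal_simps subspace_neg)
    ultimately show ?thesis
      using x IX cover_le[OF cover, of x c] cover_le[OF cover, of "- c" x] cover_in[OF cover]
      by auto
  qed
  have "subspace ?J"
    unfolding subspace_def
  proof (intro conjI ballI allI)
    show "0 \<in> ?J"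
      using I_in_J[of 0] subspace_0[OF ideal_simps(1)] cover_zero[OF cover] by simp
  next
    fix x y assume "x \<in> ?J" "y \<in> ?J"
    then obtain a b where ab: "a \<in> I" "b \<in> I" "x \<in> Y" "y \<in> Y"
      "x \<le> i a" "- i a \<le> x" "y \<le> i b" "- i b \<le> y" by blast
    have "x + y \<le> i (a + b)" "- i (a + b) \<le> x + y"
      using ab IX add_mono[of x "i a" y "i b"] add_mono[of "- i a" x "- i b" y] by auto
    then show "x + y \<in> ?J"
      using ab subspace_add[OF ideal_simps(1)] subspace_add[OF cover_subspaces(2)[OF cover]]
      by blast
  next
    fix c x assume "x \<in> ?J"
    then obtain a where a: "a \<in> I" "x \<in> Y" "x \<le> i a" "- i a \<le> x" by blast
    \<comment> \<open>A negative scalar swaps the ends of the interval, hence the absolute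
      value.\<close>
    have "c *\<^sub>R x \<le> \<bar>c\<bar> *\<^sub>R i a \<and> - (\<bar>c\<bar> *\<^sub>R i a) \<le> c *\<^sub>R x"
    proof (cases "0 \<le> c")
      case True
      then show ?thesis
        using scaleR_left_mono[OF a(3) True] scaleR_left_mono[OF a(4) True] by simp
    next
      case False
      then show ?thesis
        using scaleR_left_mono_neg[OF a(3), of c] scaleR_left_mono_neg[OF a(4), of c] by simp
    qed
    then show "c *\<^sub>R x \<in> ?J"
      using a IX subspace_scale[OF ideal_simps(1) a(1), of "\<bar>c\<bar>"]
        subspace_scale[OF cover_subspaces(2)[OF cover]] by (auto intro!: bexI[of _ "\<bar>c\<bar> *\<^sub>R a"])
  qed
  moreover have "solid_in Y ?J"
    unfolding solid_in_def
  proof (intro conjI ballI impI)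
    fix x y
    assume x: "x \<in> Y" and "y \<in> ?J" and sub: "{u. isUb Y {y, - y} u} \<subseteq> {u. isUb Y {x, - x} u}"
    then obtain a where a: "a \<in> I" "y \<le> i a" "- i a \<le> y" by blast
    \<comment> \<open>The bound \<open>i a\<close> is itself a common upper bound of
      \<open>y\<close> and \<open>- y\<close>, so solidity is tested at this single point.\<close>
    then have "isUb Y {y, - y} (i a)"
      using IX cover_in[OF cover] by (auto simp: isUb_def setle_def minus_le_iff)
    then have "isUb Y {x, - x} (i a)" using sub by blast
    then show "x \<in> ?J"
      using x a by (auto simp: isUb_def setle_def minus_le_iff)
  qed auto
  moreover have "x \<in> I" if x: "x \<in> X" "i x \<in> ?J" for x
  proof -
    obtain a where a: "a \<in> I" "i x \<le> i a" "- i a \<le> i x" using x by blast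
    then have "i (- a) \<le> i x" by (simp add: IX)
    then have "x \<le> a" "- a \<le> x"
      using a x IX cover_le[OF cover] subspace_neg[OF ideal_simps(1)] by blast+
    then show "x \<in> I"
      using solid_inD[OF ideal_simps(2) a(1) x(1)] by simp
  qed
  ultimately have ext: "extension_ideal X Y i I ?J"
    using I_in_J IX unfolding extension_ideal_def ideal_in_def by blast
  have "?J \<subseteq> J" if "extension_ideal X Y i I J" for J
    using that solid_inD[of Y J] unfolding extension_ideal_def ideal_in_def by blast
  with ext show eq: "smallest_extension_ideal X Y i I = ?J"
    unfolding smallest_extension_ideal_def by blast
  show "extension_ideal X Y i I (smallest_extension_ideal X Y i I)"
    unfolding eq by (rule ext)
qed

lemma ideal_iff: "x \<in> I \<longleftrightarrow> x \<in> X \<and> i x \<in> smallest_extension_ideal X Y i I"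
  using extension_ideal_smallest unfolding extension_ideal_def by blast

text \<open>Directedness merges the bounds for \<open>x\<close> and \<open>y\<close> into one
  \<open>c\<close> in \<open>I\<close>. This order convexity is what keeps elements found in
  \<open>Y\<close> inside the ideal.\<close>

lemma smallest_extension_ideal_between:
  assumes "x \<in> smallest_extension_ideal X Y i I" "y \<in> smallest_extension_ideal X Y i I"
    and "z \<in> Y" "x \<le> z" "z \<le> y"
  shows "z \<in> smallest_extension_ideal X Y i I"
proof -
  obtain a b where ab: "a \<in> I" "b \<in> I" "- i a \<le> x" "y \<le> i b"
    using assms(1,2) unfolding smallest_extension_ideal_eq by blast
  then obtain c where c: "c \<in> I" "a \<le> c" "b \<le> c"
    using directed unfolding directed_def by blast
  have "i a \<le> i c" "i b \<le> i c"
    using ab c ideal_simps(3) cover_le[OF cover] by blast+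
  then have "z \<le> i c" "- i c \<le> z"
    using ab assms(4,5) by (meson order_trans neg_le_iff_le)+
  then show ?thesis
    using c assms(3) unfolding smallest_extension_ideal_eq by blast
qed

lemma smallest_extension_ideal_subspace: "subspace (smallest_extension_ideal X Y i I)"
  using extension_ideal_smallest by (simp add: extension_ideal_def ideal_in_def)

lemma smallest_extension_ideal_subset: "smallest_extension_ideal X Y i I \<subseteq> Y"
  by (auto simp: smallest_extension_ideal_eq)

section \<open>Lattice structure and Dedekind completeness of the smallest extension ideal\<close>

lemma smallest_extension_ideal_vector_lattice:
  "vector_lattice_on (smallest_extension_ideal X Y i I)" (is "vector_lattice_on ?J")
  unfolding vector_lattice_on_def
proof (intro conjI ballI)
  show "subspace ?J" by (rule smallest_extension_ideal_subspace)
  note JY = subsetD[OF smallest_extension_ideal_subset]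
  fix x y assume xy: "x \<in> ?J" "y \<in> ?J"
  then obtain a b where ab: "a \<in> I" "b \<in> I" "x \<le> i a" "y \<le> i b"
    unfolding smallest_extension_ideal_eq by blast
  then obtain c where c: "c \<in> I" "a \<le> c" "b \<le> c"
    using directed unfolding directed_def by blast
  have xyc: "x \<le> i c" "y \<le> i c"
    using ab c ideal_simps(3) cover_le[OF cover] by (meson order_trans subsetD)+
  obtain s where s: "s \<in> Y" "x \<le> s" "y \<le> s"
    "\<And>u. u \<in> Y \<Longrightarrow> x \<le> u \<Longrightarrow> y \<le> u \<Longrightarrow> s \<le> u"
    using cover_sup[OF cover JY[OF xy(1)] JY[OF xy(2)]] by blast
  have ic: "i c \<in> ?J" using c ideal_iff by blast
  \<comment> \<open>The supremum formed in \<open>Y\<close> is caught between \<open>x\<close> and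
    \<open>i c\<close>, hence lies in the ideal; being least in \<open>Y\<close>, it is least there
    too.\<close>
  have "s \<le> i c" using s(4)[OF JY[OF ic]] xyc by blast
  then have "s \<in> ?J"
    using smallest_extension_ideal_between[OF xy(1) ic s(1,2)] by blast
  then show "\<exists>s. isLub ?J {x, y} s"
    using s JY unfolding isLub_iff by blast
qed

lemma smallest_extension_ideal_dedekind_complete:
  assumes "dedekind_complete_on Y"
  shows "dedekind_complete_on (smallest_extension_ideal X Y i I)" (is "dedekind_complete_on ?J")
  unfolding dedekind_complete_on_def
proof (intro allI impI)
  note JY = subsetD[OF smallest_extension_ideal_subset]
  fix M assume M: "M \<subseteq> ?J" "M \<noteq> {}" "\<exists>u. isUb ?J M u"
  then obtain u m where u: "u \<in> ?J" "\<And>x. x \<in> M \<Longrightarrow> x \<le> u" and m: "m \<in> M"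
    by (auto simp: isUb_def setle_def)
  have "isUb Y M u"
    using u JY by (auto simp: isUb_def setle_def)
  then obtain s where s: "isLub Y M s"
    using assms M JY unfolding dedekind_complete_on_def by (metis subset_iff)
  then have s': "s \<in> Y" "m \<le> s" "s \<le> u"
    using u m JY unfolding isLub_iff by blast+
  \<comment> \<open>Convexity needs a lower end as well: \<open>m\<close>, available because
    \<open>M\<close> is nonempty.\<close>
  have "s \<in> ?J"
    using smallest_extension_ideal_between[OF _ u(1) s'] m M(1) by blast
  then show "\<exists>s. isLub ?J M s"
    using s JY unfolding isLub_iff by blast
qed

section \<open>Order density and pervasiveness for the ideal\<close>

lemma smallest_extension_ideal_order_dense:
  assumes arch: "archimedean_on X" and perv: "pervasive_via X Y i"
  shows "order_dense_in (smallest_extension_ideal X Y i I) (i ` I)" (is "order_dense_in ?J _")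
proof -
  note JY = subsetD[OF smallest_extension_ideal_subset]
  note Jsub = smallest_extension_ideal_subspace
  note [simp] = cover_add[OF cover] cover_scale[OF cover] cover_diff[OF cover]
  have IX: "x \<in> X" if "x \<in> I" for x using that ideal_simps by auto
  have "subspace (i ` I)"
    unfolding subspace_def
  proof (intro conjI ballI allI)
    show "0 \<in> i ` I"
      using cover_zero[OF cover] subspace_0[OF ideal_simps(1)] by (metis imageI)
  next
    fix x y assume "x \<in> i ` I" "y \<in> i ` I"
    then obtain a b where "a \<in> I" "b \<in> I" "x = i a" "y = i b" by blast
    then show "x + y \<in> i ` I"
      using IX subspace_add[OF ideal_simps(1), of a b] by (auto intro!: image_eqI[of _ _ "a + b"])
  next
    fix c x assume "x \<in> i ` I"
    then obtain a where "a \<in> I" "x = i a" by blast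
    then show "c *\<^sub>R x \<in> i ` I"
      using IX subspace_scale[OF ideal_simps(1), of a c]
      by (auto intro!: image_eqI[of _ _ "c *\<^sub>R a"])
  qed
  moreover have "i ` I \<subseteq> ?J" using ideal_iff by blast
  moreover have "w \<le> z" if z: "z \<in> ?J" and w: "w \<in> ?J"
    and low: "\<And>d. d \<in> I \<Longrightarrow> z \<le> i d \<Longrightarrow> w \<le> i d" for z w
  proof (rule ccontr)
    assume nle: "\<not> w \<le> z"
    obtain s where "isLub ?J {w, z} s"
      using smallest_extension_ideal_vector_lattice z w
      unfolding vector_lattice_on_def by blast
    then have s: "s \<in> ?J" "w \<le> s" "z \<le> s"
      "\<And>u. u \<in> ?J \<Longrightarrow> w \<le> u \<Longrightarrow> z \<le> u \<Longrightarrow> s \<le> u"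
      unfolding isLub_iff by blast+
    have "s \<noteq> z" using s nle by auto
    then have "0 < s - z" using s by simp
    moreover have sz: "s - z \<in> ?J" using subspace_diff[OF Jsub s(1) z] .
    ultimately obtain x where x: "x \<in> X" "0 < i x" "i x \<le> s - z"
      using perv JY unfolding pervasive_via_def by blast
    have "i x \<in> ?J"
      using smallest_extension_ideal_between[OF subspace_0[OF Jsub] sz cover_in[OF cover x(1)]] x
      by simp
    then have xI: "x \<in> I" using x ideal_iff by blast
    \<comment> \<open>\<open>i d\<close> is above \<open>w\<close> and \<open>z\<close>, hence above
      their supremum \<open>s\<close>, which exceeds \<open>z\<close> by at least
      \<open>i x\<close>.\<close>
    have step: "z \<le> i (d - x)" if d: "d \<in> I" "z \<le> i d" for d
    proof -
      have "s \<le> i d" using s(4)[of "i d"] low[OF d] d ideal_iff by blast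
      moreover have "z + i x \<le> s" using x(3) by (simp add: le_diff_eq add.commute)
      ultimately show ?thesis
        using d x IX by (simp add: le_diff_eq order_trans)
    qed
    obtain d where d: "d \<in> I" "z \<le> i d"
      using z unfolding smallest_extension_ideal_eq by blast
    \<comment> \<open>\<open>z\<close> need not come from \<open>X\<close>, whereas the Archimedean
      property is used in \<open>X\<close>; \<open>- e\<close> replaces \<open>z\<close> as a lower
      bound there.\<close>
    obtain e where e: "e \<in> I" "- i e \<le> z"
      using z unfolding smallest_extension_ideal_eq by blast
    have iter: "d - real n *\<^sub>R x \<in> I \<and> z \<le> i (d - real n *\<^sub>R x)" for n
    proof (induction n)
      case (Suc n)
      have "d - real (Suc n) *\<^sub>R x = d - real n *\<^sub>R x - x" by (simp add: algebra_simps)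
      then show ?case
        using Suc step subspace_diff[OF ideal_simps(1) _ xI] by metis
    qed (use d in simp)
    \<comment> \<open>The bound \<open>d + e\<close> does not depend on \<open>n\<close>.\<close>
    have "real n *\<^sub>R x \<le> d + e" for n
    proof -
      let ?y = "d - real n *\<^sub>R x"
      have "i (- e) \<le> i ?y"
        using iter[of n] e IX cover_neg[OF cover] by (metis order_trans)
      then have "- e \<le> ?y"
        using cover_le[OF cover] iter IX e subspace_neg[OF ideal_simps(1)] by blast
      then show ?thesis by (simp add: algebra_simps)
    qed
    then have "x \<le> 0"
      using arch x(1) IX subspace_add[OF ideal_simps(1) d(1) e(1)]
      unfolding archimedean_on_def by blast
    then show False
      using x cover_pos[OF cover] by (simp add: less_le_not_le)
  qed
  ultimately show ?thesis
    by (simp add: order_dense_in_def isGlb_iff)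
qed

lemma pervasive_via_smallest_extension_ideal:
  assumes "archimedean_on X" and perv: "pervasive_via X Y i"
  shows "pervasive_via I (smallest_extension_ideal X Y i I) i" (is "pervasive_via I ?J i")
  unfolding pervasive_via_def
proof (intro conjI ballI impI)
  show "vector_lattice_cover I ?J i"
    using cover ideal_simps(1,3) ideal_iff smallest_extension_ideal_vector_lattice
      smallest_extension_ideal_order_dense[OF assms]
    by (auto simp: vector_lattice_cover_def linear_on_def bipositive_on_def subset_iff)
next
  fix y assume y: "y \<in> ?J" "0 < y"
  then obtain x where x: "x \<in> X" "0 < i x" "i x \<le> y"
    using perv smallest_extension_ideal_subset unfolding pervasive_via_def by blast
  \<comment> \<open>Pervasiveness of \<open>X\<close> only yields \<open>x\<close> in
    \<open>X\<close>; since \<open>i x\<close> lies between 0 and \<open>y\<close>, the extension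
    property then places \<open>x\<close> in \<open>I\<close>.\<close>
  have "i x \<in> ?J"
    using smallest_extension_ideal_between[OF subspace_0[OF smallest_extension_ideal_subspace]
        y(1) cover_in[OF cover x(1)]] x by simp
  then show "\<exists>x\<in>I. 0 < i x \<and> i x \<le> y"
    using x ideal_iff by blast
qed

end

theorem corollary28:
  fixes X :: "'a::ordered_real_vector set"
    and Xd :: "'b::ordered_real_vector set" and i :: "'a \<Rightarrow> 'b"
    and W :: "'c::ordered_real_vector set" and j :: "'a \<Rightarrow> 'c"
    and I :: "'a set"
  assumes "archimedean_on X"
    and "pervasive_via X W j"
    and "dedekind_completion X Xd i"
    and "ideal_in X I" and "directed I"
  shows "dedekind_completion I (smallest_extension_ideal X Xd i I) i
    \<and> pervasive_via I (smallest_extension_ideal X Xd i I) i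
    \<and> (\<forall>(V :: 'd::ordered_real_vector set) k.
          vector_lattice_cover I V k \<longrightarrow> pervasive_via I V k)"
proof -
  have cover: "vector_lattice_cover X Xd i" and complete: "dedekind_complete_on Xd"
    using assms(3) by (auto simp: dedekind_completion_def)
  \<comment> \<open>Pervasiveness is given through the cover \<open>W\<close> and is first carried
    over to the completion \<open>Xd\<close>.\<close>
  have "pervasive_via I (smallest_extension_ideal X Xd i I) i"
    using pervasive_via_smallest_extension_ideal[OF cover assms(4,5,1)]
      pervasive_via_transfer[OF assms(2) cover] by blast
  moreover from this have "vector_lattice_cover I V k \<longrightarrow> pervasive_via I V k"
    for V :: "'d set" and k
    using pervasive_via_transfer by blast
  moreover have "archimedean_on I"
    using assms(1) ideal_simps(3)[OF cover assms(4,5)] unfolding archimedean_on_def by blast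
  ultimately show ?thesis
    using smallest_extension_ideal_dedekind_complete[OF cover assms(4,5) complete] assms(5)
    unfolding dedekind_completion_def pervasive_via_def by blast
qed

end
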